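(* There exist constants $c>0$ and $n_0$ such that for every positive integer $n\equiv 0\pmod 4$ and every positive integer $p$, if $n\geq n_0$ and $n-4p\geq c\log^2 n$, then there exists a globally simple Heffter array $H(n;4p+3)$.
   Context: A Heffter array $H(n;k)$ is an $n\times n$ array of integers (some cells may be empty) such that: each row and each column contains exactly $k$ filled cells; the entries in every row and every column sum to $0$ modulo $2nk+1$; and for each integer $1\leq x\leq nk$, either $x$ or $-x$ appears in the array. Rows and columns are indexed by $0,1,\dots,n-1$. The natural ordering of a row lists its filled cells from left to right (increasing column index), and that of a column from top to bottom (increasing row index). The array is globally simple if, for every row and every column, writing its entries in natural order as $a_0,\dots,a_{k-1}$, the partial sums $\sum_{j=0}^{i}a_j$, $i=0,\dots,k-1$, are pairwise distinct modulo $2nk+1$. *)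

theory Defs
  imports Complex_Main "HOL-Number_Theory.Cong"
begin

text \<open>
  A partially filled square array of side n is a function of the row and the column index, where
  None marks an empty cell. Only the values at indices below n matter.
\<close>

type_synonym parray = "nat \<Rightarrow> nat \<Rightarrow> int option"

text \<open>The entries of the filled cells of a row or a column, in the natural ordering.\<close>

definition row_entries :: "nat \<Rightarrow> parray \<Rightarrow> nat \<Rightarrow> int list" where
  "row_entries n A i = List.map_filter (\<lambda>j. A i j) [0..<n]"

definition col_entries :: "nat \<Rightarrow> parray \<Rightarrow> nat \<Rightarrow> int list" where
  "col_entries n A j = List.map_filter (\<lambda>i. A i j) [0..<n]"

text \<open>
  There are exactly n * k filled cells, so the last condition, although written with an inclusive
  disjunction, forces exactly one of x and -x to appear, exactly once, and no other entries.
\<close>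

definition heffter_array :: "nat \<Rightarrow> nat \<Rightarrow> parray \<Rightarrow> bool" where
  "heffter_array n k A \<longleftrightarrow>
     (\<forall>i<n. card {j. j < n \<and> A i j \<noteq> None} = k) \<and>
     (\<forall>j<n. card {i. i < n \<and> A i j \<noteq> None} = k) \<and>
     (\<forall>i<n. [sum_list (row_entries n A i) = 0] (mod int (2 * n * k + 1))) \<and>
     (\<forall>j<n. [sum_list (col_entries n A j) = 0] (mod int (2 * n * k + 1))) \<and>
     (\<forall>x::int. 1 \<le> x \<and> x \<le> int (n * k) \<longrightarrow>
        (\<exists>i<n. \<exists>j<n. A i j = Some x \<or> A i j = Some (- x)))"

definition simple_modulo :: "int \<Rightarrow> int list \<Rightarrow> bool" where
  "simple_modulo m xs \<longleftrightarrow>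
     (\<forall>i<length xs. \<forall>j<length xs. i \<noteq> j \<longrightarrow>
        \<not> [(\<Sum>l\<le>i. xs ! l) = (\<Sum>l\<le>j. xs ! l)] (mod m))"

definition globally_simple :: "nat \<Rightarrow> nat \<Rightarrow> parray \<Rightarrow> bool" where
  "globally_simple n k A \<longleftrightarrow>
     (\<forall>i<n. simple_modulo (int (2 * n * k + 1)) (row_entries n A i)) \<and>
     (\<forall>j<n. simple_modulo (int (2 * n * k + 1)) (col_entries n A j))"

end

theory Submission
  imports Defs
begin

text \<open>
  Let \<open>n = 4m\<close> with \<open>m \<ge> p + 3\<close>. A Heffter array \<open>H(n;3)\<close> with entries up to \<open>3n\<close> is obtained from
  one cyclic sequence \<open>y\<close>: put \<open>z\<^sub>i = y\<^sub>i\<^sub>-\<^sub>1 + 3m\<close> and \<open>x\<^sub>i = -(y\<^sub>i + z\<^sub>i)\<close>; then \<open>x\<^sub>i, y\<^sub>i, z\<^sub>i\<close> is a zero sum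
  row and \<open>x\<^sub>i, y\<^sub>i\<^sub>-\<^sub>1, z\<^sub>i\<^sub>+\<^sub>1\<close> a zero sum column. Listing its rows and columns in steps of the unit \<open>2m + 1\<close>
  modulo \<open>4m\<close> places \<open>y\<close> and \<open>z\<close> on two diagonals at distance 2 and \<open>x\<close> on a diagonal opposite to them.

  The numbers above \<open>3n\<close> are cut into blocks of length \<open>2n\<close>, each block into odd and even positions, and
  these fill \<open>2p\<close> pairs of adjacent diagonals, \<open>p\<close> pairs on either side of \<open>x\<close>. The two entries of a pair
  have opposite signs, and their sum is \<open>-1\<close> for the first \<open>p - 1\<close> pairs, then \<open>2n\<close>, then \<open>1\<close> for
  \<open>p - 1\<close> pairs, then \<open>-2n\<close> (in a column up to an error of at most 4). Since the order within a row is
  relevant only up to rotation, the partial sums are small or close to \<open>2n\<close> between the pairs, lie in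
  pairwise disjoint intervals inside the pairs, and are shifted by \<open>x\<close> from its diagonal on. They span
  less than the modulus, so it suffices that they are distinct integers. This gives the array whenever
  \<open>n \<ge> 4p + 12\<close>.
\<close>

section \<open>Partial sums of lists\<close>

lemma sum_nth_atMost_eq_take:
  fixes xs :: "int list"
  assumes "i < length xs"
  shows "(\<Sum>l\<le>i. xs ! l) = sum_list (take (Suc i) xs)"
proof -
  have "(\<Sum>l\<le>i. xs ! l) = (\<Sum>l = 0..<Suc i. take (Suc i) xs ! l)"
    by (rule sum.cong) auto
  also have "\<dots> = sum_list (take (Suc i) xs)"
    using assms by (simp add: sum_list_sum_nth)
  finally show ?thesis .
qed

lemma simple_modulo_iff_inj_on_take:
  "simple_modulo M xs \<longleftrightarrow> inj_on (\<lambda>i. sum_list (take i xs) mod M) {1..length xs}"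
proof -
  have "simple_modulo M xs \<longleftrightarrow> inj_on (\<lambda>i. sum_list (take (Suc i) xs) mod M) {..<length xs}"
    unfolding simple_modulo_def inj_on_def
    by (auto simp: sum_nth_atMost_eq_take cong_def)
  also have "\<dots> \<longleftrightarrow> inj_on ((\<lambda>i. sum_list (take i xs) mod M) \<circ> Suc) {..<length xs}"
    by (simp add: o_def)
  also have "\<dots> \<longleftrightarrow> inj_on (\<lambda>i. sum_list (take i xs) mod M) (Suc ` {..<length xs})"
    by (rule comp_inj_on_iff[symmetric]) simp
  also have "Suc ` {..<length xs} = {1..length xs}"
    by (auto simp: image_Suc_lessThan)
  finally show ?thesis .
qed

text \<open>When the total vanishes modulo \<open>M\<close>, the full sum and the empty sum agree,
  so the last index may be traded for index 0.\<close>

lemma simple_modulo_iff_inj_on_take':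
  assumes "sum_list xs mod M = 0"
  shows "simple_modulo M xs \<longleftrightarrow> inj_on (\<lambda>i. sum_list (take i xs) mod M) {..<length xs}"
proof -
  let ?S = "\<lambda>i. sum_list (take i xs) mod M" and ?l = "length xs"
  show ?thesis
  proof (cases "?l = 0")
    case False
    then have "1 \<le> ?l"
      by linarith
    then have 1: "{1..?l} = insert ?l {1..<?l}" and 2: "{..<?l} = insert 0 {1..<?l}"
      by auto
    have "?S ?l = ?S 0"
      using assms by simp
    then show ?thesis
      unfolding simple_modulo_iff_inj_on_take 1 2 inj_on_insert by simp
  qed (simp add: simple_modulo_iff_inj_on_take)
qed

text \<open>A prefix sum of the reversed list is the total minus a prefix sum of complementary
  length. This maps lengths \<open>1..l\<close> to \<open>0..l-1\<close>, which is harmless as the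
  total is 0 modulo \<open>M\<close>.\<close>

lemma simple_modulo_rev:
  assumes "sum_list xs mod M = 0"
  shows "simple_modulo M (rev xs) \<longleftrightarrow> simple_modulo M xs"
proof -
  let ?l = "length xs"
  have *: "sum_list (take i (rev xs)) = sum_list xs - sum_list (take (?l - i) xs)" for i
  proof -
    have "sum_list xs = sum_list (take (?l - i) xs) + sum_list (drop (?l - i) xs)"
      by (metis append_take_drop_id sum_list_append)
    then show ?thesis
      by (simp add: take_rev sum_list_rev)
  qed
  have "(sum_list xs - a) mod M = (sum_list xs - b) mod M \<longleftrightarrow> a mod M = b mod M" for a b
    by (simp add: mod_eq_dvd_iff dvd_diff_commute)
  then have "simple_modulo M (rev xs) \<longleftrightarrow>
      inj_on ((\<lambda>i. sum_list (take i xs) mod M) \<circ> (\<lambda>i. ?l - i)) {1..?l}"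
    unfolding simple_modulo_iff_inj_on_take * inj_on_def by simp
  also have "\<dots> \<longleftrightarrow> inj_on (\<lambda>i. sum_list (take i xs) mod M) ((\<lambda>i. ?l - i) ` {1..?l})"
    by (rule comp_inj_on_iff[symmetric]) (auto simp: inj_on_def)
  also have "(\<lambda>i. ?l - i) ` {1..?l} = {..<?l}"
  proof (intro equalityI subsetI)
    fix i assume "i \<in> {..<?l}"
    then show "i \<in> (\<lambda>i. ?l - i) ` {1..?l}"
      by (intro image_eqI[of _ _ "?l - i"]) auto
  qed auto
  finally show ?thesis
    using simple_modulo_iff_inj_on_take'[OF assms] by simp
qed

text \<open>Each partial sum is taken before its entry is added, so the total is not listed.\<close>

fun partial_sums :: "int \<Rightarrow> int list \<Rightarrow> int list" where
  "partial_sums s [] = []"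
| "partial_sums s (x # xs) = s # partial_sums (s + x) xs"

lemma partial_sums_append:
  "partial_sums s (xs @ ys) = partial_sums s xs @ partial_sums (s + sum_list xs) ys"
  by (induction xs arbitrary: s) (auto simp: algebra_simps)

lemma partial_sums_add: "partial_sums (d + s) xs = map ((+) d) (partial_sums s xs)"
proof (induction xs arbitrary: s)
  case (Cons x xs)
  show ?case
    using Cons[of "s + x"] by (simp add: algebra_simps)
qed simp

lemma partial_sums_eq_map_take:
  "partial_sums s xs = map (\<lambda>i. s + sum_list (take i xs)) [0..<length xs]"
proof (induction xs arbitrary: s)
  case (Cons x xs)
  have "[0..<length (x # xs)] = 0 # map Suc [0..<length xs]"
    by (simp add: map_Suc_upt upt_conv_Cons del: upt_Suc)
  then show ?case
    using Cons[of "s + x"] by (simp add: o_def algebra_simps del: upt_Suc)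
qed simp

lemma simple_modulo_iff_partial_sums:
  assumes "sum_list xs mod M = 0"
  shows "simple_modulo M xs \<longleftrightarrow> distinct (map (\<lambda>s. s mod M) (partial_sums 0 xs))"
  unfolding simple_modulo_iff_inj_on_take'[OF assms] partial_sums_eq_map_take
  by (simp add: distinct_map o_def lessThan_atLeast0)

lemma distinct_map_mod_add:
  fixes l :: "int list"
  shows "distinct (map (\<lambda>s. s mod M) (map ((+) d) l)) \<longleftrightarrow> distinct (map (\<lambda>s. s mod M) l)"
proof -
  have "(d + a) mod M = (d + b) mod M \<longleftrightarrow> a mod M = b mod M" for a b
    using cong_add_lcancel[of d a b M] by (simp add: cong_def)
  then show ?thesis
    by (auto simp: distinct_map inj_on_def)
qed

text \<open>Starting the cyclic reading elsewhere translates all partial sums by the constant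
  \<open>sum_list xs\<close>, and the zero total closes the cycle.\<close>

lemma simple_modulo_append_commute:
  assumes "sum_list (xs @ ys) mod M = 0"
  shows "simple_modulo M (ys @ xs) \<longleftrightarrow> simple_modulo M (xs @ ys)"
proof -
  let ?m = "map (\<lambda>s. s mod M)" and ?a = "sum_list xs" and ?b = "sum_list ys"
  have ba: "(?a + (?b + s)) mod M = s mod M" for s
    using assms by (metis add.assoc add_0 mod_add_left_eq sum_list_append)
  have "simple_modulo M (ys @ xs) \<longleftrightarrow> distinct (?m (partial_sums 0 (ys @ xs)))"
    using assms by (intro simple_modulo_iff_partial_sums) (simp add: add.commute)
  also have "\<dots> \<longleftrightarrow> distinct (?m (map ((+) ?a) (partial_sums 0 (ys @ xs))))"
    by (rule distinct_map_mod_add[symmetric])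
  also have "?m (map ((+) ?a) (partial_sums 0 (ys @ xs))) =
      ?m (partial_sums ?a ys) @ ?m (partial_sums 0 xs)"
    using partial_sums_add[of ?a 0 ys] partial_sums_add[of ?b 0 xs]
    by (simp add: partial_sums_append o_def ba)
  also have "distinct \<dots> \<longleftrightarrow> distinct (?m (partial_sums 0 (xs @ ys)))"
    by (auto simp: partial_sums_append)
  also have "\<dots> \<longleftrightarrow> simple_modulo M (xs @ ys)"
    using simple_modulo_iff_partial_sums[OF assms] by simp
  finally show ?thesis .
qed

section \<open>Reading rows and columns cyclically along the diagonals\<close>

lemma map_filter_append:
  "List.map_filter f (xs @ ys) = List.map_filter f xs @ List.map_filter f ys"
  by (simp add: List.map_filter_def)

lemma map_filter_rev: "List.map_filter f (rev xs) = rev (List.map_filter f xs)"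
  by (simp add: List.map_filter_def rev_filter rev_map)

lemma map_filter_map: "List.map_filter f (map g xs) = List.map_filter (f \<circ> g) xs"
  by (simp add: List.map_filter_def filter_map o_def)

lemma simple_modulo_map_filter_rotate:
  assumes "sum_list (List.map_filter f (rotate k xs)) mod M = 0"
  shows "simple_modulo M (List.map_filter f (rotate k xs)) \<longleftrightarrow> simple_modulo M (List.map_filter f xs)"
proof -
  let ?a = "take (k mod length xs) xs" and ?b = "drop (k mod length xs) xs"
  have "List.map_filter f xs = List.map_filter f ?a @ List.map_filter f ?b"
    by (simp flip: map_filter_append)
  moreover have "List.map_filter f (rotate k xs) = List.map_filter f ?b @ List.map_filter f ?a"
    by (simp add: rotate_drop_take map_filter_append)
  ultimately show ?thesis
    using assms simple_modulo_append_commute by metis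
qed

lemma mset_map_filter_rotate:
  "mset (List.map_filter f (rotate k xs)) = mset (List.map_filter f xs)"
proof -
  have "mset (List.map_filter f xs) =
      mset (List.map_filter f (take (k mod length xs) xs @ drop (k mod length xs) xs))"
    by simp
  then show ?thesis
    by (simp only: map_filter_append rotate_drop_take mset_append add.commute)
qed

lemma rotate_upt: "rotate k [0..<n] = map (\<lambda>q. (q + k) mod n) [0..<n]"
  by (rule nth_equalityI) (auto simp: nth_rotate add.commute)

text \<open>Row \<open>r\<close> meets diagonal \<open>q\<close> in column \<open>q + r\<close>, so
  reading by increasing \<open>q\<close> is a rotation of the natural order.\<close>

lemma row_entries_cyclic:
  assumes L: "List.map_filter (\<lambda>q. A r ((q + r) mod n)) [0..<n] = L" and M: "sum_list L = 0"
  shows "mset (row_entries n A r) = mset L"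
    and "simple_modulo M (row_entries n A r) \<longleftrightarrow> simple_modulo M L"
proof -
  have "List.map_filter (A r) (rotate r [0..<n]) = L"
    using L unfolding rotate_upt map_filter_map by (simp add: o_def)
  then show "mset (row_entries n A r) = mset L"
      "simple_modulo M (row_entries n A r) \<longleftrightarrow> simple_modulo M L"
    using M mset_map_filter_rotate[of "A r" r "[0..<n]"]
      simple_modulo_map_filter_rotate[of "A r" r "[0..<n]" M]
    by (auto simp: row_entries_def)
qed

text \<open>Column \<open>c\<close> meets diagonal \<open>q\<close> in row \<open>c - q\<close>.
  Increasing \<open>q\<close> thus goes upwards, and the reading is the reversal of a rotation by
  \<open>c + 1\<close>; both operations preserve simplicity for a zero total.\<close>

lemma col_entries_cyclic:
  assumes L: "List.map_filter (\<lambda>q. A ((c + n - q) mod n) c) [0..<n] = L" and M: "sum_list L = 0"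
  shows "mset (col_entries n A c) = mset L"
    and "simple_modulo M (col_entries n A c) \<longleftrightarrow> simple_modulo M L"
proof -
  let ?f = "\<lambda>r. A r c"
  have eq: "map (\<lambda>q. (c + n - q) mod n) [0..<n] = rev (rotate (Suc c) [0..<n])"
  proof (rule nth_equalityI)
    fix i assume "i < length (map (\<lambda>q. (c + n - q) mod n) [0..<n])"
    then have i: "i < n" by simp
    then have "c + n - i = Suc c + (n - Suc i)" by simp
    with i show "map (\<lambda>q. (c + n - q) mod n) [0..<n] ! i = rev (rotate (Suc c) [0..<n]) ! i"
      by (simp add: rev_nth nth_rotate del: rotate_Suc)
  qed simp
  have "List.map_filter ?f (rev (rotate (Suc c) [0..<n])) = L"
    using L unfolding eq[symmetric] map_filter_map by (simp add: o_def)
  then have rL: "List.map_filter ?f (rotate (Suc c) [0..<n]) = rev L"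
    unfolding map_filter_rev by (metis rev_rev_ident)
  then show "mset (col_entries n A c) = mset L"
    using mset_map_filter_rotate[of ?f "Suc c" "[0..<n]"]
    by (simp add: col_entries_def del: rotate_Suc)
  have "simple_modulo M (col_entries n A c) \<longleftrightarrow> simple_modulo M (rev L)"
    using simple_modulo_map_filter_rotate[of ?f "Suc c" "[0..<n]" M] rL M
    by (simp add: col_entries_def sum_list_rev del: rotate_Suc)
  also have "\<dots> \<longleftrightarrow> simple_modulo M L"
    using M by (intro simple_modulo_rev) simp
  finally show "simple_modulo M (col_entries n A c) \<longleftrightarrow> simple_modulo M L" .
qed

section \<open>Lists of pairs, filled cells, and residues in an interval\<close>

lemma map_filter_upt_pairs:
  assumes "\<And>i. i < k \<Longrightarrow> f (s + 2 * i) = Some (g i)"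
    and "\<And>i. i < k \<Longrightarrow> f (Suc (s + 2 * i)) = Some (h i)"
  shows "List.map_filter f [s..<s + 2 * k] = concat (map (\<lambda>i. [g i, h i]) [0..<k])"
  using assms by (induction k) (simp_all add: map_filter_append List.map_filter_def)

lemma card_row_col_entries:
  "card {j. j < n \<and> A i j \<noteq> None} = length (row_entries n A i)"
  "card {i. i < n \<and> A i j \<noteq> None} = length (col_entries n A j)"
proof -
  have *: "card {i. i < n \<and> f i \<noteq> None} = length (List.map_filter f [0..<n])" for f :: "nat \<Rightarrow> int option"
  proof -
    have "{i. i < n \<and> f i \<noteq> None} = {i. i < length [0..<n] \<and> f ([0..<n] ! i) \<noteq> None}"
      by auto
    then show ?thesis
      by (simp only: List.map_filter_def length_map length_filter_conv_card)
  qed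
  show "card {j. j < n \<and> A i j \<noteq> None} = length (row_entries n A i)"
      "card {i. i < n \<and> A i j \<noteq> None} = length (col_entries n A j)"
    unfolding row_entries_def col_entries_def by (rule *)+
qed

lemma map_filter_None: "(\<And>x. x \<in> set xs \<Longrightarrow> f x = None) \<Longrightarrow> List.map_filter f xs = []"
  by (induction xs) (auto simp: List.map_filter_def)

lemma upt_append: "i \<le> j \<Longrightarrow> j \<le> k \<Longrightarrow> [i..<j] @ [j..<k] = [i..<k]"
  using upt_add_eq_append[of i j "k - j"] by simp

lemma set_concat_pairs:
  "set (concat (map (\<lambda>j. [f j, g j]) [i..<k])) = f ` {i..<k} \<union> g ` {i..<k}"
  by auto

lemma distinct_concat_pairs:
  assumes "inj_on f {i..<k}" "inj_on g {i..<k}"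
    and "\<And>a b. a \<in> {i..<k} \<Longrightarrow> b \<in> {i..<k} \<Longrightarrow> f a \<noteq> g b"
  shows "distinct (concat (map (\<lambda>j. [f j, g j]) [i..<k]))"
  using assms
proof (induction k)
  case (Suc k)
  show ?case
  proof (cases "i \<le> k")
    case True
    then have *: "{i..<Suc k} = insert k {i..<k}"
      by auto
    have "distinct (concat (map (\<lambda>j. [f j, g j]) [i..<k]))"
      using Suc.prems unfolding * by (intro Suc.IH) auto
    moreover have "f k \<notin> f ` {i..<k}" "g k \<notin> g ` {i..<k}"
      using Suc.prems(1,2) unfolding * inj_on_insert by auto
    moreover have "f k \<noteq> g k" "f k \<notin> g ` {i..<k}" "g k \<notin> f ` {i..<k}"
      using Suc.prems(3) unfolding * by (auto, metis insertI1 insertI2 atLeastLessThan_iff)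
    moreover have "concat (map (\<lambda>j. [f j, g j]) [i..<Suc k]) =
        concat (map (\<lambda>j. [f j, g j]) [i..<k]) @ [f k, g k]"
      using True by simp
    ultimately show ?thesis
      unfolding set_concat_pairs distinct_append by (simp only: set_concat_pairs distinct_append) auto
  qed simp
qed simp

lemma inj_on_mod_int: "inj_on (\<lambda>s. s mod M) {lo..<lo + M}" for M lo :: int
proof (rule inj_onI)
  fix x y
  assume *: "x \<in> {lo..<lo + M}" "y \<in> {lo..<lo + M}" "x mod M = y mod M"
  then have "M dvd x - y"
    by (simp add: mod_eq_dvd_iff)
  moreover have "\<bar>x - y\<bar> < M"
    using *(1,2) by auto
  ultimately show "x = y"
    using dvd_imp_le_int[of "x - y" M] by (cases "x = y") auto
qed

section \<open>Simplicity of a cyclic list of pairs\<close>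

locale heffter_params =
  fixes m p :: nat
  assumes p_pos: "0 < p" and p_less: "p + 3 \<le> m"
begin

text \<open>
  The two entries of pair \<open>j\<close> are \<open>sg j * (al j + 2 * u)\<close> and \<open>- sg j * (be j + 2 * v)\<close> with
  \<open>1 \<le> u, v \<le> n\<close>. In a row \<open>u = v\<close>; in a column \<open>2 * (u - v)\<close> is up to sign an error \<open>D\<close> that depends on
  the column only. \<open>T j\<close> is the sum of the pairs before \<open>j\<close> without these errors, and \<open>E j\<close> is the number
  of times, counted with sign, that \<open>D\<close> has been added there.
\<close>

definition sg :: "nat \<Rightarrow> int" where
  "sg j = (if Suc j = 2 * p then - 1 else 1)"

text \<open>With \<open>n = 4m\<close>, block \<open>B\<close> is the interval of length
  \<open>8m\<close> that starts at \<open>12m + 8mB + 1\<close>. Pair \<open>j\<close> uses block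
  \<open>p - j\<close> if \<open>j < p - 1\<close>, and block \<open>j + 1\<close> if
  \<open>p \<le> j < 2p - 1\<close>. Blocks 0 and 1 are shared: pair \<open>p - 1\<close> takes
  their odd positions and pair \<open>2p - 1\<close> their even ones, which gives the sums
  \<open>8m\<close> and \<open>-8m\<close>.\<close>

definition al :: "nat \<Rightarrow> int" where
  "al j = 12 * int m + (if j < p then 8 * (int m * (int p - int j)) - 1
     else if Suc j = 2 * p then 8 * int m else 8 * (int m * (int j + 1)))"

definition be :: "nat \<Rightarrow> int" where
  "be j = 12 * int m + (if Suc j < p then 8 * (int m * (int p - int j)) else if Suc j = p then - 1
     else if Suc j = 2 * p then 0 else 8 * (int m * (int j + 1)) - 1)"

text \<open>The errors cancel over two consecutive pairs, so they never accumulate. The sign -1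
  before \<open>p\<close> keeps the sums away from a small positive \<open>X\<close>; from
  \<open>p\<close> on the sign is chosen so that \<open>E j - E p = 1\<close> whenever
  \<open>j\<close> and \<open>p\<close> differ in parity.\<close>

definition E :: "nat \<Rightarrow> int" where
  "E j = (if even j then 0 else if j < p \<or> odd p then - 1 else 1)"

definition T :: "nat \<Rightarrow> int" where
  "T j = (if j < p then - int j else if j < 2 * p then 8 * int m - 2 * int p + 1 + int j else 0)"

lemma T_Suc: "j < 2 * p \<Longrightarrow> T (Suc j) = T j + sg j * (al j - be j)"
proof -
  assume "j < 2 * p"
  then consider "Suc j < p" | "Suc j = p" | "p \<le> j" "Suc j < 2 * p" | "p \<le> j" "Suc j = 2 * p"
    using p_pos by linarith
  then show ?thesis
    using p_pos by cases (auto simp: T_def sg_def al_def be_def algebra_simps)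
qed

lemma E_simps: "E 0 = 0" "E (2 * p) = 0" "even j \<Longrightarrow> E j = 0"
  by (auto simp: E_def)

text \<open>
  The values \<open>F j\<close> and \<open>H j\<close> are the partial sums of the pairs before and inside pair \<open>j\<close>.
\<close>

context
  fixes u v :: "nat \<Rightarrow> int" and D X Y Z :: int
begin

definition F :: "nat \<Rightarrow> int" where "F j = T j + E j * D"

definition H :: "nat \<Rightarrow> int" where "H j = F j + sg j * (al j + 2 * u j)"

definition pair :: "nat \<Rightarrow> int list" where
  "pair j = [sg j * (al j + 2 * u j), - (sg j * (be j + 2 * v j))]"

text \<open>The common shape of all rows and columns when read along the diagonals.\<close>

definition cyc_list :: "int list" where
  "cyc_list = concat (map pair [0..<p]) @ [X] @ concat (map pair [p..<2 * p]) @ [Z, Y]"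

text \<open>The ranges are those of the array with three entries per line. The sign condition on
  \<open>D\<close> excludes the collisions \<open>F j = X\<close> and \<open>F p = X + F j\<close>,
  where size and parity leave only \<open>X = 1\<close> and \<open>X = 3\<close>.\<close>

context
  assumes XYZ: "X + Y + Z = 0"
    and X: "1 \<le> X \<and> X \<le> 2 * int m \<or> - (5 * int m) \<le> X \<and> X \<le> - (3 * int m) - 1"
    and Y: "6 * int m + 1 \<le> Y \<and> Y \<le> 8 * int m \<or> - (6 * int m) \<le> Y \<and> Y \<le> - (5 * int m) - 1 \<or>
      - (12 * int m) \<le> Y \<and> Y \<le> - (11 * int m) - 1"
    and Z: "9 * int m + 1 \<le> Z \<or> Z \<le> - (2 * int m) - 1"
    and D: "\<bar>D\<bar> \<le> 4" "even D" "X = 1 \<or> X = 3 \<Longrightarrow> 0 \<le> D"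
    and u: "\<And>j. 1 \<le> u j \<and> u j \<le> 4 * int m" and v: "\<And>j. 1 \<le> v j \<and> v j \<le> 4 * int m"
    and uv: "\<And>j. j < 2 * p \<Longrightarrow> sg j * (2 * (u j - v j)) = (E (Suc j) - E j) * D"
begin

lemma F_Suc: "j < 2 * p \<Longrightarrow> F (Suc j) = H j - sg j * (be j + 2 * v j)"
  using T_Suc[of j] uv[of j] by (simp add: F_def H_def algebra_simps)

lemma sum_list_pairs:
  "i \<le> k \<Longrightarrow> k \<le> 2 * p \<Longrightarrow> sum_list (concat (map pair [i..<k])) = F k - F i"
proof (induction k)
  case (Suc k)
  then show ?case
    using F_Suc[of k] by (cases "i = Suc k") (auto simp: pair_def H_def)
qed simp

lemma partial_sums_pairs:
  "i \<le> k \<Longrightarrow> k \<le> 2 * p \<Longrightarrow> partial_sums (s + F i) (concat (map pair [i..<k])) =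
     concat (map (\<lambda>j. [s + F j, s + H j]) [i..<k])"
proof (induction k)
  case (Suc k)
  show ?case
  proof (cases "i = Suc k")
    case False
    then have "i \<le> k"
      using Suc by simp
    then show ?thesis
      using Suc sum_list_pairs[of i k] by (simp add: partial_sums_append) (simp add: pair_def H_def)
  qed simp
qed simp

lemma F_0: "F 0 = 0" and F_2p: "F (2 * p) = 0"
  using p_pos by (simp_all add: F_def T_def E_simps)

lemma sum_cyc_list: "sum_list cyc_list = 0"
  using XYZ by (simp add: cyc_list_def sum_list_pairs F_0 F_2p)

lemma partial_sums_cyc_list:
  "partial_sums 0 cyc_list = concat (map (\<lambda>j. [F j, H j]) [0..<p]) @ [F p] @
     concat (map (\<lambda>j. [X + F j, X + H j]) [p..<2 * p]) @ [X, - Y]"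
proof -
  have "partial_sums 0 (concat (map pair [0..<p])) = concat (map (\<lambda>j. [F j, H j]) [0..<p])"
    using partial_sums_pairs[of 0 p 0] by (simp add: F_0)
  moreover have "partial_sums (F p + X) (concat (map pair [p..<2 * p])) =
      concat (map (\<lambda>j. [X + F j, X + H j]) [p..<2 * p])"
    using partial_sums_pairs[of p "2 * p" X] by (simp add: add.commute)
  ultimately show ?thesis
    using XYZ by (simp add: cyc_list_def partial_sums_append sum_list_pairs F_0 F_2p)
qed

text \<open>The error is absorbed: for even \<open>j\<close> none is present and
  \<open>w = u j\<close>; for odd \<open>j\<close> the error before the pair is the one that the
  pair cancels, so replacing \<open>u j\<close> by \<open>v j\<close> removes it.\<close>

lemma H_eq:
  assumes "j < 2 * p"
  obtains w where "1 \<le> w" "w \<le> 4 * int m" "H j = T j + sg j * (al j + 2 * w)"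
proof (cases "even j")
  case True
  then show ?thesis
    using that[OF u[of j, THEN conjunct1] u[of j, THEN conjunct2]] by (simp add: H_def F_def E_simps)
next
  case False
  then show ?thesis
    using that[OF v[of j, THEN conjunct1] v[of j, THEN conjunct2]] uv[OF assms] E_simps(3)[of "Suc j"]
    by (simp add: H_def F_def algebra_simps)
qed

section \<open>Intervals containing the partial sums\<close>

lemma H_first:
  assumes "j < p"
  obtains w where "1 \<le> w" "w \<le> 4 * int m" "H j = 12 * int m + 8 * (int m * (int p - int j)) - 1 - int j + 2 * w"
proof -
  have "j < 2 * p" "Suc j \<noteq> 2 * p"
    using assms p_pos by linarith+
  then show ?thesis
    using H_eq[of j] that assms by (simp add: T_def sg_def al_def algebra_simps) blast
qed

lemma H_second:
  assumes "p \<le> j" "Suc j < 2 * p"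
  obtains w where "1 \<le> w" "w \<le> 4 * int m" "H j = 20 * int m + 8 * (int m * (int j + 1)) - 2 * int p + 1 + int j + 2 * w"
proof -
  have "j < 2 * p" "\<not> j < p"
    using assms by linarith+
  then show ?thesis
    using H_eq[of j] that assms by (simp add: T_def sg_def al_def algebra_simps) blast
qed

lemma H_last:
  assumes "Suc j = 2 * p"
  obtains w where "1 \<le> w" "w \<le> 4 * int m" "H j = - (12 * int m) - 2 * w"
proof -
  have j: "p \<le> j" "j < 2 * p" "int j = 2 * int p - 1"
    using assms p_pos by auto
  obtain w where w: "1 \<le> w" "w \<le> 4 * int m" "H j = T j + sg j * (al j + 2 * w)"
    using H_eq[OF j(2)] .
  show ?thesis
    using w j assms by (intro that[OF w(1,2)]) (simp add: T_def sg_def al_def)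
qed

lemma int_p: "1 \<le> int p" "int p + 3 \<le> int m"
  using p_pos p_less by linarith+

lemma E_D_bounds: "\<bar>E j * D\<bar> \<le> 4" "even (E j * D)"
  using D(1,2) by (auto simp: E_def)

lemma F_first: "j < p \<Longrightarrow> - int p - 3 \<le> F j \<and> F j \<le> 3"
  using E_D_bounds(1)[of j] by (cases "j = 0") (auto simp: F_def T_def E_simps)

lemma F_second: "p \<le> j \<Longrightarrow> j < 2 * p \<Longrightarrow> 8 * int m - int p - 3 \<le> F j \<and> F j \<le> 8 * int m + 4"
  using E_D_bounds(1)[of j] by (auto simp: F_def T_def)

lemma m_mult_mono: "a \<le> b \<Longrightarrow> int m * a \<le> int m * b" for a b :: int
  by (simp add: mult_left_mono)

lemma H_first_bounds:
  assumes "j < p"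
  shows "20 * int m - int p + 2 \<le> H j" "H j \<le> 20 * int m + 8 * (int m * int p) - 1"
proof -
  obtain w where w: "1 \<le> w" "w \<le> 4 * int m" "H j = 12 * int m + 8 * (int m * (int p - int j)) - 1 - int j + 2 * w"
    using H_first[OF assms] by blast
  have "int m * 1 \<le> int m * (int p - int j)" "int m * (int p - int j) \<le> int m * int p"
    using assms by (intro m_mult_mono; simp)+
  with w assms show "20 * int m - int p + 2 \<le> H j" "H j \<le> 20 * int m + 8 * (int m * int p) - 1"
    by linarith+
qed

lemma H_second_bounds:
  assumes "p \<le> j" "Suc j < 2 * p"
  shows "28 * int m + 8 * (int m * int p) - int p \<le> H j"
    and "H j \<le> 20 * int m + 16 * (int m * int p) - 1" and "2 \<le> p"
proof -
  obtain w where w: "1 \<le> w" "w \<le> 4 * int m"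
      "H j = 20 * int m + 8 * (int m * (int j + 1)) - 2 * int p + 1 + int j + 2 * w"
    using H_second[OF assms] by blast
  have "int m * (int p + 1) \<le> int m * (int j + 1)" "int m * (int j + 1) \<le> int m * (2 * int p - 1)"
    using assms by (intro m_mult_mono; simp)+
  then have "int m * int p + int m \<le> int m * (int j + 1)"
      "int m * (int j + 1) \<le> 2 * (int m * int p) - int m"
    by (simp_all add: algebra_simps)
  with w assms show "28 * int m + 8 * (int m * int p) - int p \<le> H j"
      "H j \<le> 20 * int m + 16 * (int m * int p) - 1"
    by linarith+
  show "2 \<le> p"
    using assms by linarith
qed

lemma H_last_bounds:
  assumes "Suc j = 2 * p"
  shows "- (20 * int m) \<le> H j" "H j \<le> - (12 * int m) - 2"
  using H_last[OF assms] by (smt (verit))+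

text \<open>The block used drops by one from each pair to the next. This outweighs the variation of
  \<open>2 * w\<close>, which is less than \<open>8m\<close>, and the term \<open>- j\<close> moves
  in the same direction.\<close>

lemma inj_on_H_first: "inj_on H {0..<p}"
proof -
  have "H j \<noteq> H j'" if "j < j'" "j' < p" for j j'
  proof -
    have "int m * (int p - int j' + 1) \<le> int m * (int p - int j)"
      using that by (intro m_mult_mono) simp
    then have "int m * (int p - int j') + int m \<le> int m * (int p - int j)"
      by (simp add: algebra_simps)
    then show ?thesis
      using that H_first[of j] H_first[of j'] by (smt (verit) of_nat_less_iff less_trans)
  qed
  then show ?thesis
    by (intro linorder_inj_onI) auto
qed

text \<open>Here the blocks increase, except that the last pair has the opposite sign and gives a
  negative sum.\<close>

lemma inj_on_H_second: "inj_on H {p..<2 * p}"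
proof -
  have "H j \<noteq> H j'" if "p \<le> j" "j < j'" "j' < 2 * p" for j j'
  proof (cases "Suc j' = 2 * p")
    case True
    have "0 \<le> int m * int p"
      by simp
    then show ?thesis
      using that True H_second_bounds(1)[of j] H_last_bounds(2)[of j'] int_p by linarith
  next
    case False
    have "int m * (int j + 1 + 1) \<le> int m * (int j' + 1)"
      using that by (intro m_mult_mono) simp
    then have "int m * (int j + 1) + int m \<le> int m * (int j' + 1)"
      by (simp add: algebra_simps)
    then show ?thesis
      using that False H_second[of j] H_second[of j']
      by (smt (verit) of_nat_less_iff less_trans Suc_lessI le_trans less_imp_le Suc_mono)
  qed
  then show ?thesis
    by (intro linorder_inj_onI) auto
qed

section \<open>Distinctness of the partial sums\<close>

lemma even_F: "j < p \<Longrightarrow> even (F j) \<longleftrightarrow> even j"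
    "p \<le> j \<Longrightarrow> j < 2 * p \<Longrightarrow> even (F j) \<longleftrightarrow> odd j"
  using E_D_bounds(2)[of j] by (auto simp: F_def T_def)

text \<open>As \<open>D\<close> is even, equal sums force indices of equal parity. These have the
  same \<open>E\<close> within one half, so the values of \<open>T\<close> agree, and
  \<open>T\<close> is injective there.\<close>

lemma inj_on_F_first: "inj_on F {0..<p}"
proof (rule inj_onI)
  fix i j assume *: "i \<in> {0..<p}" "j \<in> {0..<p}" "F i = F j"
  then have "even i \<longleftrightarrow> even j"
    using even_F(1)[of i] even_F(1)[of j] by simp
  then show "i = j"
    using * by (auto simp: F_def T_def E_def split: if_splits)
qed

lemma inj_on_F_second: "inj_on F {p..<2 * p}"
proof (rule inj_onI)
  fix i j assume *: "i \<in> {p..<2 * p}" "j \<in> {p..<2 * p}" "F i = F j"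
  then have "even i \<longleftrightarrow> even j"
    using even_F(2)[of i] even_F(2)[of j] by simp
  then show "i = j"
    using * by (auto simp: F_def T_def E_def split: if_splits)
qed

text \<open>By size \<open>X\<close> could only be 1, 2 or 3. For even \<open>j\<close> the sum is
  \<open>- j\<close>, which is not positive. For odd \<open>j\<close> it is odd, so \<open>X\<close>
  is 1 or 3; then \<open>D\<close> is nonnegative and \<open>F j = - j - D\<close> is
  negative.\<close>

lemma F_first_neq_X:
  assumes "j < p"
  shows "F j \<noteq> X"
proof
  assume eq: "F j = X"
  then have pos: "1 \<le> F j" "F j \<le> 3"
    using X F_first[OF assms] int_p by linarith+
  have "odd j"
    using pos assms by (auto simp: F_def T_def E_def split: if_splits)
  then have "odd (F j)"
    using even_F(1)[OF assms] by simp
  then have "X = 1 \<or> X = 3"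
    using pos eq by presburger
  then show False
    using D(3) pos assms \<open>odd j\<close> by (auto simp: F_def T_def E_def split: if_splits)
qed

text \<open>The one place where the sign of \<open>E\<close> on the second half of the pairs matters.\<close>

lemma F_p_neq_second:
  assumes "p \<le> j" "j < 2 * p"
  shows "F p \<noteq> X + F j"
proof
  assume eq: "F p = X + F j"
  show False
  proof (cases "even p \<longleftrightarrow> even j")
    case True
    then have "E p = E j"
      using assms by (auto simp: E_def)
    then have "X = int p - int j"
      using eq assms by (simp add: F_def T_def)
    then show False
      using X assms int_p by linarith
  next
    case False
    then have "E j * D - E p * D = D"
      using assms by (auto simp: E_def)
    then have X': "X = int p - int j - D"
      using eq assms by (simp add: F_def T_def)
    then have "odd X"
      using False D(2) by simp
    moreover have "X \<le> 4"
      using X' D(1) assms by linarith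
    moreover have "- int p - 4 \<le> X"
      using X' D(1) assms by linarith
    ultimately have "odd X" "1 \<le> X" "X \<le> 4"
      using X int_p by linarith+
    then have "X = 1 \<or> X = 3"
      by presburger
    then show False
      using D(3) X' assms by linarith
  qed
qed

text \<open>The modulus is \<open>2nk + 1\<close> for \<open>n = 4m\<close> and
  \<open>k = 4p + 3\<close>. The interval bounds separate all kinds of partial sums except
  \<open>F j\<close> from \<open>X\<close> and \<open>F p\<close> from \<open>X + F j\<close>, which
  are treated above.\<close>

lemma simple_cyc_list:
  "simple_modulo (32 * (int m * int p) + 24 * int m + 1) cyc_list"
proof -
  let ?M = "32 * (int m * int p) + 24 * int m + 1"
  let ?A = "concat (map (\<lambda>j. [F j, H j]) [0..<p])"
  let ?B = "concat (map (\<lambda>j. [X + F j, X + H j]) [p..<2 * p])"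
  have mp: "int m \<le> int m * int p"
    using m_mult_mono[of 1 "int p"] int_p by simp
  have Fp: "8 * int m - int p - 3 \<le> F p" "F p \<le> 8 * int m + 4"
    using F_second[of p] p_pos by auto
  have H1: "19 * int m \<le> H j" "H j \<le> 20 * int m + 8 * (int m * int p) - 1" if "j < p" for j
    using H_first_bounds[OF that] int_p by auto
  have H2: "H j \<le> - (12 * int m) - 2 \<and> - (20 * int m) \<le> H j \<or>
      27 * int m + 8 * (int m * int p) \<le> H j \<and> H j \<le> 30 * (int m * int p) - 3 * int m"
    if "p \<le> j" "j < 2 * p" for j
  proof (cases "Suc j = 2 * p")
    case False
    then have "Suc j < 2 * p"
      using that by simp
    note b = H_second_bounds[OF that(1) this]
    \<comment> \<open>A pair that is neither in the first half nor last exists only for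
      \<open>2 \<le> p\<close>. This is what lets its upper bound fit below the end of the interval
      of length \<open>?M\<close> chosen later.\<close>
    have "2 * int m \<le> int m * int p"
      using m_mult_mono[of 2 "int p"] b(3) by simp
    then show ?thesis
      using b(1,2) int_p by linarith
  qed (use H_last_bounds[of j] in auto)
  have A: "distinct ?A"
  proof (rule distinct_concat_pairs[OF inj_on_F_first inj_on_H_first])
    fix a b assume "a \<in> {0..<p}" "b \<in> {0..<p}"
    then show "F a \<noteq> H b"
      using F_first[of a] H1(1)[of b] int_p by auto
  qed
  have B: "distinct ?B"
  proof (rule distinct_concat_pairs)
    show "inj_on (\<lambda>j. X + F j) {p..<2 * p}" "inj_on (\<lambda>j. X + H j) {p..<2 * p}"
      using inj_onD[OF inj_on_F_second] inj_onD[OF inj_on_H_second] by (auto intro!: inj_onI)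
    fix a b assume "a \<in> {p..<2 * p}" "b \<in> {p..<2 * p}"
    then show "X + F a \<noteq> X + H b"
      using F_second[of a] H2[of b] mp int_p by auto
  qed
  have AB: "set ?A \<inter> set ?B = {}"
  proof -
    have "F a \<noteq> X + F b" "F a \<noteq> X + H b" "H a \<noteq> X + F b" "H a \<noteq> X + H b"
      if "a < p" "p \<le> b" "b < 2 * p" for a b
      using F_first[OF that(1)] F_second[OF that(2,3)] H1[OF that(1)] H2[OF that(2,3)] X mp int_p
      by linarith+
    then show ?thesis
      unfolding set_concat_pairs by fastforce
  qed
  have Fp_A: "F p \<notin> set ?A"
  proof -
    have "F p \<noteq> F a" "F p \<noteq> H a" if "a < p" for a
      using F_first[OF that] H1(1)[OF that] Fp int_p by linarith+
    then show ?thesis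
      unfolding set_concat_pairs by fastforce
  qed
  have Fp_B: "F p \<notin> set ?B"
  proof -
    have "F p \<noteq> X + H b" if "p \<le> b" "b < 2 * p" for b
      using H2[OF that] Fp X mp int_p by linarith
    then show ?thesis
      unfolding set_concat_pairs using F_p_neq_second by fastforce
  qed
  have X_A: "X \<notin> set ?A" "- Y \<notin> set ?A"
  proof -
    have "X \<noteq> H a" "- Y \<noteq> F a" "- Y \<noteq> H a" if "a < p" for a
      using F_first[OF that] H1(1)[OF that] X Y int_p by linarith+
    then show "X \<notin> set ?A" "- Y \<notin> set ?A"
      unfolding set_concat_pairs using F_first_neq_X by fastforce+
  qed
  have X_B: "X \<notin> set ?B" "- Y \<notin> set ?B"
  proof -
    \<comment> \<open>Since \<open>- Y = X + Z\<close>, the third inequality compares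
      \<open>Z\<close> with \<open>F b\<close>, which is close to \<open>8m\<close>.\<close>
    have "X \<noteq> X + F b" "X \<noteq> X + H b" "- Y \<noteq> X + F b" "- Y \<noteq> X + H b"
      if "p \<le> b" "b < 2 * p" for b
      using F_second[OF that] H2[OF that] X Y Z XYZ mp int_p by linarith+
    then show "X \<notin> set ?B" "- Y \<notin> set ?B"
      unfolding set_concat_pairs by fastforce+
  qed
  have "F p \<noteq> X" "F p \<noteq> - Y" "X \<noteq> - Y"
    using Fp X Y Z XYZ int_p by linarith+
  then have "distinct (partial_sums 0 cyc_list)"
    unfolding partial_sums_cyc_list using A B AB Fp_A Fp_B X_A X_B by auto
  \<comment> \<open>The lower end is the least \<open>X\<close>, namely \<open>-5m\<close>, plus the
    lower bound \<open>-20m\<close> for \<open>H\<close> at the last pair.\<close>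
  moreover have "set (partial_sums 0 cyc_list) \<subseteq> {- (25 * int m)..<- (25 * int m) + ?M}"
  proof -
    let ?I = "{- (25 * int m)..<- (25 * int m) + ?M}"
    have "F a \<in> ?I" "H a \<in> ?I" if "a < p" for a
      using F_first[OF that] H1[OF that] mp int_p
      unfolding atLeastLessThan_iff by ((intro conjI; linarith)+)
    moreover have "X + F b \<in> ?I" "X + H b \<in> ?I" if "p \<le> b" "b < 2 * p" for b
      using F_second[OF that] H2[OF that] X mp int_p
      unfolding atLeastLessThan_iff by ((intro conjI; linarith)+)
    moreover have "F p \<in> ?I" "X \<in> ?I" "- Y \<in> ?I"
      using Fp X Y mp int_p unfolding atLeastLessThan_iff by ((intro conjI; linarith)+)
    ultimately show ?thesis
      unfolding partial_sums_cyc_list set_append set_concat_pairs by auto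
  qed
  ultimately have "distinct (map (\<lambda>s. s mod ?M) (partial_sums 0 cyc_list))"
    unfolding distinct_map using inj_on_subset[OF inj_on_mod_int] by blast
  then show ?thesis
    using simple_modulo_iff_partial_sums sum_cyc_list by simp
qed

end

end

section \<open>The array\<close>

text \<open>The absolute values fill \<open>5m+1..8m\<close> and \<open>11m+1..12m\<close>. The
  signs make the shift by \<open>3m\<close> send them onto \<open>8m+1..11m\<close> and
  \<open>2m+1..3m\<close>.\<close>

definition yv :: "nat \<Rightarrow> int" where
  "yv i = (if odd i then 8 * int m - int (i div 2)
     else if i < 2 * m then - (11 * int m + 1 + int (i div 2))
     else - (4 * int m + 1 + int (i div 2)))"

definition prev :: "nat \<Rightarrow> nat" where
  "prev i = (if i = 0 then 4 * m - 1 else i - 1)"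

definition zv :: "nat \<Rightarrow> int" where
  "zv i = yv (prev i) + 3 * int m"

definition xv :: "nat \<Rightarrow> int" where
  "xv i = - (yv i + zv i)"

text \<open>
  A bijection onto \<open>{1..4m}\<close> whose values at cyclically adjacent arguments differ by at most 2,
  which makes the column error small in every column.
\<close>

definition zig :: "nat \<Rightarrow> int" where
  "zig t = (if t < 2 * m then 2 * int t + 1 else 2 * (4 * int m - int t))"

text \<open>The reflection of \<open>zig\<close> fixes the sign of the error of each pair: its size
  then depends on the column only, and its sign follows the steps of \<open>E\<close>.\<close>

definition U :: "nat \<Rightarrow> nat \<Rightarrow> int" where
  "U j t = (if sg j * (E (Suc j) - E j) = 1 then zig t else 4 * int m + 1 - zig t)"

text \<open>The two cells of a pair in one row lie in adjacent columns, so the shifts 2 and 1 give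
  them the same argument of \<open>U\<close>. In a column the arguments are cyclically adjacent. The
  shift 2 also aligns this argument with the index of \<open>x\<close> in odd columns.\<close>

definition pv :: "nat \<Rightarrow> bool \<Rightarrow> nat \<Rightarrow> int" where
  "pv j left c = (if left then sg j * (al j + 2 * U j ((c + 2) mod (4 * m)))
     else - (sg j * (be j + 2 * U j ((c + 1) mod (4 * m)))))"

text \<open>This is \<open>(2m + 1) r mod 4m\<close>, which is an involution.\<close>

definition idx :: "nat \<Rightarrow> nat" where
  "idx r = (if even r then r else r + 2 * m) mod (4 * m)"

text \<open>The diagonal \<open>q\<close> consists of the cells whose column minus row is \<open>q\<close> modulo \<open>4m\<close>.\<close>

definition cell :: "nat \<Rightarrow> nat \<Rightarrow> nat \<Rightarrow> int option" where
  "cell q r c =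
    (if q < 2 * p then Some (pv (q div 2) (even q) c)
     else if q = 2 * m - 2 then Some (xv (idx r))
     else if 2 * m - 1 \<le> q \<and> q < 2 * m - 1 + 2 * p
       then Some (pv (p + (q - (2 * m - 1)) div 2) (even (q - (2 * m - 1))) c)
     else if q = 4 * m - 3 then Some (zv (idx r))
     else if q = 4 * m - 1 then Some (yv (idx r))
     else None)"

definition arr :: parray where
  "arr r c = cell ((c + 4 * m - r) mod (4 * m)) r c"

section \<open>The cells met along the diagonals\<close>

lemma m_ge: "4 \<le> m" "p + 3 \<le> m"
  using p_pos p_less by linarith+

lemma arr_row:
  assumes "r < 4 * m" "q < 4 * m"
  shows "arr r ((q + r) mod (4 * m)) = cell q r ((q + r) mod (4 * m))"
proof -
  have "((q + r) mod (4 * m) + 4 * m - r) mod (4 * m) = ((q + r) mod (4 * m) + (4 * m - r)) mod (4 * m)"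
    using assms by simp
  also have "\<dots> = (q + r + (4 * m - r)) mod (4 * m)"
    by (simp add: mod_add_left_eq)
  also have "\<dots> = q"
    using assms by simp
  finally show ?thesis
    by (simp add: arr_def)
qed

lemma arr_col:
  assumes "c < 4 * m" "q < 4 * m"
  shows "arr ((c + 4 * m - q) mod (4 * m)) c = cell q ((c + 4 * m - q) mod (4 * m)) c"
proof -
  have "(c + 4 * m - (c + 4 * m - q) mod (4 * m)) mod (4 * m) = q"
  proof (cases "q \<le> c")
    case True
    then have "c + 4 * m - q = c - q + 4 * m"
      by simp
    moreover have "(c - q + 4 * m) mod (4 * m) = c - q"
      using assms by simp
    ultimately have "(c + 4 * m - q) mod (4 * m) = c - q"
      by (simp only:)
    moreover have "c + 4 * m - (c - q) = q + 4 * m"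
      using True by simp
    moreover have "(q + 4 * m) mod (4 * m) = q"
      using assms by simp
    ultimately show ?thesis
      by (simp only:)
  qed (use assms in simp)
  then show ?thesis
    by (simp add: arr_def)
qed

definition off :: "nat \<Rightarrow> nat" where
  "off j = (if j < p then 2 * j else 2 * m - 1 + 2 * (j - p))"

lemma upt_4m:
  "[0..<4 * m] = [0..<0 + 2 * p] @ [2 * p..<2 * m - 2] @ [2 * m - 2] @
    [2 * m - 1..<2 * m - 1 + 2 * p] @ [2 * m - 1 + 2 * p..<4 * m - 3] @ [4 * m - 3, 4 * m - 2, 4 * m - 1]"
proof -
  have "Suc (2 * m - 2) = 2 * m - 1" "Suc (4 * m - 3) = 4 * m - 2" "Suc (4 * m - 2) = 4 * m - 1"
      "Suc (4 * m - 1) = 4 * m"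
    using m_ge by linarith+
  then have "[2 * m - 2] = [2 * m - 2..<2 * m - 1]" "[4 * m - 3, 4 * m - 2, 4 * m - 1] = [4 * m - 3..<4 * m]"
    using upt_conv_Cons[of "2 * m - 2" "2 * m - 1"] upt_conv_Cons[of "4 * m - 3" "4 * m"]
      upt_conv_Cons[of "4 * m - 2" "4 * m"] upt_conv_Cons[of "4 * m - 1" "4 * m"] m_ge
    by simp_all
  moreover have "[0..<4 * m] = [0..<0 + 2 * p] @ [2 * p..<2 * m - 2] @ [2 * m - 2..<2 * m - 1] @
      [2 * m - 1..<2 * m - 1 + 2 * p] @ [2 * m - 1 + 2 * p..<4 * m - 3] @ [4 * m - 3..<4 * m]"
  proof -
    have split: "[x..<4 * m] = [x..<y] @ [y..<4 * m]" if "x \<le> y" "y \<le> 4 * m" for x y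
      using upt_append[OF that] by simp
    have "[0..<4 * m] = [0..<0 + 2 * p] @ [0 + 2 * p..<4 * m]"
      by (rule split) (use m_ge in linarith)+
    also have "[0 + 2 * p..<4 * m] = [2 * p..<2 * m - 2] @ [2 * m - 2..<4 * m]"
      unfolding add_0 by (rule split) (use m_ge in linarith)+
    also have "[2 * m - 2..<4 * m] = [2 * m - 2..<2 * m - 1] @ [2 * m - 1..<4 * m]"
      by (rule split) (use m_ge in linarith)+
    also have "[2 * m - 1..<4 * m] = [2 * m - 1..<2 * m - 1 + 2 * p] @ [2 * m - 1 + 2 * p..<4 * m]"
      by (rule split) (use m_ge in linarith)+
    also have "[2 * m - 1 + 2 * p..<4 * m] = [2 * m - 1 + 2 * p..<4 * m - 3] @ [4 * m - 3..<4 * m]"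
      by (rule split) (use m_ge in linarith)+
    finally show ?thesis .
  qed
  ultimately show ?thesis
    by (simp only:)
qed

lemma cell_simps:
  "cell (2 * m - 2) r c = Some (xv (idx r))"
  "cell (4 * m - 3) r c = Some (zv (idx r))"
  "cell (4 * m - 2) r c = None"
  "cell (4 * m - 1) r c = Some (yv (idx r))"
proof -
  have "\<not> 2 * m - 2 < 2 * p" "\<not> 4 * m - 3 < 2 * p" "\<not> 4 * m - 2 < 2 * p" "\<not> 4 * m - 1 < 2 * p"
    "4 * m - 3 \<noteq> 2 * m - 2" "4 * m - 2 \<noteq> 2 * m - 2" "4 * m - 1 \<noteq> 2 * m - 2"
    "\<not> 4 * m - 3 < 2 * m - 1 + 2 * p" "\<not> 4 * m - 2 < 2 * m - 1 + 2 * p" "\<not> 4 * m - 1 < 2 * m - 1 + 2 * p"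
    "4 * m - 2 \<noteq> 4 * m - 3" "4 * m - 1 \<noteq> 4 * m - 3" "4 * m - 2 \<noteq> 4 * m - 1"
    using m_ge by linarith+
  then show "cell (2 * m - 2) r c = Some (xv (idx r))" "cell (4 * m - 3) r c = Some (zv (idx r))"
    "cell (4 * m - 2) r c = None" "cell (4 * m - 1) r c = Some (yv (idx r))"
    unfolding cell_def by (simp_all only: if_True if_False simp_thms)
qed

text \<open>Row and column positions are arbitrary functions of the diagonal, so that one
  computation serves both rows and columns.\<close>

lemma map_filter_cell:
  fixes \<rho> \<kappa> :: "nat \<Rightarrow> nat"
  defines "g \<equiv> \<lambda>j. [pv j True (\<kappa> (off j)), pv j False (\<kappa> (Suc (off j)))]"
  shows "List.map_filter (\<lambda>q. cell q (\<rho> q) (\<kappa> q)) [0..<4 * m] =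
    concat (map g [0..<p]) @ [xv (idx (\<rho> (2 * m - 2)))] @ concat (map g [p..<2 * p]) @
    [zv (idx (\<rho> (4 * m - 3))), yv (idx (\<rho> (4 * m - 1)))]"
proof -
  let ?f = "\<lambda>q. cell q (\<rho> q) (\<kappa> q)"
  have "List.map_filter ?f [0..<0 + 2 * p] = concat (map g [0..<p])"
  proof -
    have "List.map_filter ?f [0..<0 + 2 * p] =
        concat (map (\<lambda>j. [pv j True (\<kappa> (2 * j)), pv j False (\<kappa> (Suc (2 * j)))]) [0..<p])"
      by (rule map_filter_upt_pairs) (auto simp: cell_def)
    also have "\<dots> = concat (map g [0..<p])"
      by (intro arg_cong[of _ _ concat] map_cong) (auto simp: g_def off_def)
    finally show ?thesis .
  qed
  moreover have "List.map_filter ?f [2 * m - 1..<2 * m - 1 + 2 * p] = concat (map g [p..<2 * p])"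
  proof -
    have "List.map_filter ?f [2 * m - 1..<2 * m - 1 + 2 * p] = concat (map (\<lambda>j. g (j + p)) [0..<p])"
      unfolding g_def by (rule map_filter_upt_pairs) (use m_ge in \<open>auto simp: cell_def off_def add.commute\<close>)
    also have "map (\<lambda>j. g (j + p)) [0..<p] = map g [p..<2 * p]"
      using map_add_upt[of p p, symmetric] by (simp add: mult_2 o_def)
    finally show ?thesis .
  qed
  moreover have "List.map_filter ?f [2 * p..<2 * m - 2] = []"
      "List.map_filter ?f [2 * m - 1 + 2 * p..<4 * m - 3] = []"
    using m_ge by (auto intro!: map_filter_None simp: cell_def)
  moreover have "List.map_filter ?f [2 * m - 2] = [xv (idx (\<rho> (2 * m - 2)))]"
      "List.map_filter ?f [4 * m - 3, 4 * m - 2, 4 * m - 1] =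
        [zv (idx (\<rho> (4 * m - 3))), yv (idx (\<rho> (4 * m - 1)))]"
    by (simp_all only: List.map_filter_def o_def filter.simps cell_simps list.map option.simps if_True if_False simp_thms option.sel)
  ultimately show ?thesis
    unfolding upt_4m by (simp only: map_filter_append append_Nil append_assoc)
qed

section \<open>Values and ranges of the entries\<close>

lemma zig_bounds: "t < 4 * m \<Longrightarrow> 1 \<le> zig t \<and> zig t \<le> 4 * int m"
  by (auto simp: zig_def)

lemma U_bounds: "t < 4 * m \<Longrightarrow> 1 \<le> U j t \<and> U j t \<le> 4 * int m"
  using zig_bounds[of t] by (auto simp: U_def)

lemma zig_surj:
  assumes "1 \<le> w" "w \<le> 4 * int m"
  shows "\<exists>t<4 * m. zig t = w"
proof (cases "even w")
  case True
  then obtain h where h: "w = 2 * h" ..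
  show ?thesis
    using assms h by (intro exI[of _ "4 * m - nat h"]) (auto simp: zig_def of_nat_diff)
next
  case False
  then obtain h where h: "w = 2 * h + 1" by (rule oddE)
  show ?thesis
    using assms h by (intro exI[of _ "nat h"]) (auto simp: zig_def)
qed

lemma U_surj:
  assumes "1 \<le> w" "w \<le> 4 * int m"
  shows "\<exists>t<4 * m. U j t = w"
proof (cases "sg j * (E (Suc j) - E j) = 1")
  case True
  then show ?thesis
    using zig_surj[OF assms] by (simp add: U_def)
next
  case False
  then show ?thesis
    using zig_surj[of "4 * int m + 1 - w"] assms by (auto simp: U_def)
qed

lemma zig_step:
  assumes "s < 4 * m" "t = Suc s mod (4 * m)"
  shows "\<bar>zig t - zig s\<bar> \<le> 2" and "t \<noteq> 0 \<Longrightarrow> t < 2 * m \<Longrightarrow> zig s \<le> zig t"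
proof -
  show "\<bar>zig t - zig s\<bar> \<le> 2"
    using assms m_ge by (cases "Suc s = 4 * m") (auto simp: zig_def)
  show "t \<noteq> 0 \<Longrightarrow> t < 2 * m \<Longrightarrow> zig s \<le> zig t"
    using assms m_ge by (cases "Suc s = 4 * m") (auto simp: zig_def)
qed

lemma abs_E_step: "j < 2 * p \<Longrightarrow> \<bar>E (Suc j) - E j\<bar> = 1"
  by (auto simp: E_def)

lemma U_diff:
  assumes "j < 2 * p"
  shows "sg j * (2 * (U j t - U j s)) = (E (Suc j) - E j) * (2 * (zig t - zig s))"
proof -
  obtain e where e: "E (Suc j) - E j = e" "e = 1 \<or> e = - 1"
    using abs_E_step[OF assms] by (metis abs_eq_iff abs_1)
  have "sg j = 1 \<or> sg j = - 1"
    by (simp add: sg_def)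
  then show ?thesis
    unfolding U_def e(1) using e(2) by auto
qed

lemma yv_cases:
  assumes "i < 4 * m"
  shows "6 * int m + 1 \<le> yv i \<and> yv i \<le> 8 * int m \<or> - (6 * int m) \<le> yv i \<and> yv i \<le> - (5 * int m) - 1 \<or>
      - (12 * int m) \<le> yv i \<and> yv i \<le> - (11 * int m) - 1"
proof (cases "even i")
  case True
  then obtain h where "i = 2 * h" ..
  then show ?thesis using assms by (auto simp: yv_def)
next
  case False
  then obtain h where "i = 2 * h + 1" by (rule oddE)
  then show ?thesis using assms by (auto simp: yv_def)
qed

lemma prev_less: "i < 4 * m \<Longrightarrow> prev i < 4 * m"
  by (auto simp: prev_def)

lemma prev_Suc_mod: "prev (Suc a mod (4 * m)) = a mod (4 * m)"
  using m_ge by (auto simp: prev_def mod_Suc)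

lemma zv_cases:
  "i < 4 * m \<Longrightarrow> 9 * int m + 1 \<le> zv i \<or> zv i \<le> - (2 * int m) - 1"
  using yv_cases[OF prev_less[of i]] by (auto simp: zv_def)

text \<open>On each of its pieces \<open>yv i\<close> is a constant minus \<open>i div 2\<close>, so
  sums of consecutive terms decrease by one at each step. The wrap-around at \<open>i = 0\<close>
  supplies the value \<open>2m\<close> that is missing from \<open>1..2m-1\<close>.\<close>

lemma xv_eq:
  assumes "i < 4 * m"
  shows "xv i = (if i = 0 then 2 * int m else if i < 2 * m then int i else int i - 7 * int m)"
proof -
  consider "i = 0" | h where "i = 2 * h + 1" | h where "i = 2 * h" "0 < h"
    by (metis evenE gr0I mult_0_right oddE)
  then show ?thesis
  proof cases
    case 1
    then have "prev i = 2 * (2 * m - 1) + 1"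
      using m_ge by (simp add: prev_def)
    then show ?thesis
      using 1 m_ge by (simp add: xv_def zv_def yv_def of_nat_diff)
  next
    case 2
    then show ?thesis
      using assms m_ge by (simp add: xv_def zv_def prev_def yv_def)
  next
    case 3
    then have "prev i = 2 * (h - 1) + 1"
      by (simp add: prev_def)
    then show ?thesis
      using 3 assms m_ge by (simp add: xv_def zv_def yv_def of_nat_diff)
  qed
qed

lemma xv_cases:
  assumes "i < 4 * m"
  shows "1 \<le> xv i \<and> xv i \<le> 2 * int m \<or> - (5 * int m) \<le> xv i \<and> xv i \<le> - (3 * int m) - 1"
  using assms m_ge by (auto simp: xv_eq)

lemma idx_less: "idx r < 4 * m"
  using m_ge by (simp add: idx_def)

lemma even_mod_4m: "even (a mod (4 * m)) \<longleftrightarrow> even a"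
  by (simp add: dvd_mod_iff)

lemma idx_idx: "r < 4 * m \<Longrightarrow> idx (idx r) = r"
  by (auto simp: idx_def even_mod_4m mod_add_left_eq)

lemma idx_mod: "idx (a mod (4 * m)) = (if even a then a else a + 2 * m) mod (4 * m)"
  by (auto simp: idx_def even_mod_4m mod_add_left_eq)

section \<open>Rows and columns as instances of the cyclic list\<close>

definition modulus :: int where
  "modulus = 32 * (int m * int p) + 24 * int m + 1"

lemma length_cyc_list: "length (cyc_list u v X Y Z) = 4 * p + 3"
proof -
  have "length (concat (map (pair u v) [i..<k])) = 2 * (k - i)" for i k
    by (induction k) (auto simp: pair_def)
  then show ?thesis
    by (simp add: cyc_list_def)
qed

text \<open>In a row both entries of a pair use the same value of \<open>U\<close>, so the error
  \<open>D\<close> is 0.\<close>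

lemma row_cyclic:
  assumes r: "r < 4 * m"
  shows "sum_list (row_entries (4 * m) arr r) = 0"
    and "length (row_entries (4 * m) arr r) = 4 * p + 3"
    and "simple_modulo modulus (row_entries (4 * m) arr r)"
proof -
  define u where "u j = U j ((off j + r + 2) mod (4 * m))" for j
  define L where "L = cyc_list u u (xv (idx r)) (yv (idx r)) (zv (idx r))"
  have XYZ: "xv (idx r) + yv (idx r) + zv (idx r) = 0"
    by (simp add: xv_def)
  have u: "1 \<le> u j \<and> u j \<le> 4 * int m" for j
    unfolding u_def using m_ge by (intro U_bounds) simp
  note sums = sum_cyc_list[OF XYZ xv_cases[OF idx_less] yv_cases[OF idx_less] zv_cases[OF idx_less], of 0 u u]
  note simp = simple_cyc_list[OF XYZ xv_cases[OF idx_less] yv_cases[OF idx_less] zv_cases[OF idx_less], of 0 u u]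
  have sL: "sum_list L = 0"
    unfolding L_def by (rule sums) (use u in auto)
  have simpL: "simple_modulo modulus L"
    unfolding L_def modulus_def by (rule simp) (use u in auto)
  have "List.map_filter (\<lambda>q. arr r ((q + r) mod (4 * m))) [0..<4 * m] =
      List.map_filter (\<lambda>q. cell q r ((q + r) mod (4 * m))) [0..<4 * m]"
    unfolding List.map_filter_def using arr_row[OF r] by (auto intro!: map_cong filter_cong)
  also have "\<dots> = L"
  proof -
    have "[pv j True ((off j + r) mod (4 * m)), pv j False ((Suc (off j) + r) mod (4 * m))] = pair u u j" for j
    proof -
      have "((off j + r) mod (4 * m) + 2) mod (4 * m) = (off j + r + 2) mod (4 * m)"
        by (rule mod_add_left_eq)
      moreover have "((Suc (off j) + r) mod (4 * m) + 1) mod (4 * m) = (off j + r + 2) mod (4 * m)"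
        unfolding mod_add_left_eq by simp
      ultimately show ?thesis
        by (simp only: pv_def pair_def u_def if_True if_False)
    qed
    then show ?thesis
      unfolding map_filter_cell L_def cyc_list_def by simp
  qed
  finally have L: "List.map_filter (\<lambda>q. arr r ((q + r) mod (4 * m))) [0..<4 * m] = L" .
  note row_entries_cyclic[where A = arr and n = "4 * m" and r = r, OF L sL]
  then show "sum_list (row_entries (4 * m) arr r) = 0"
      "length (row_entries (4 * m) arr r) = 4 * p + 3"
      "simple_modulo modulus (row_entries (4 * m) arr r)"
    using sL simpL length_cyc_list unfolding L_def by (metis sum_mset_sum_list, metis size_mset, blast)
qed

text \<open>A column contains \<open>x\<close> at some index \<open>i\<close>, \<open>y\<close> at
  \<open>i - 1\<close> and \<open>z\<close> at \<open>i + 1\<close>. Its pairs carry the error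
  \<open>D\<close>, twice a step of \<open>zig\<close>.\<close>

lemma col_cyclic:
  assumes c: "c < 4 * m"
  shows "sum_list (col_entries (4 * m) arr c) = 0"
    and "length (col_entries (4 * m) arr c) = 4 * p + 3"
    and "simple_modulo modulus (col_entries (4 * m) arr c)"
proof -
  define s t where "s = (c + 1) mod (4 * m)" and "t = (c + 2) mod (4 * m)"
  define u v where "u j = U j t" and "v j = U j s" for j
  define D where "D = 2 * (zig t - zig s)"
  \<comment> \<open>The entry \<open>x\<close> of column \<open>c\<close> lies in row
    \<open>c + 2m + 2\<close> modulo \<open>4m\<close>, and \<open>i\<close> is \<open>idx\<close>
    of that row.\<close>
  define i where "i = (if even c then c + 2 * m + 2 else c + 2) mod (4 * m)"
  define L where "L = cyc_list u v (xv i) (yv (prev i)) (yv i + 3 * int m)"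
  have m4: "0 < 4 * m"
    using m_ge by simp
  have i: "i < 4 * m" "prev i < 4 * m" and st: "s < 4 * m" "t < 4 * m" "t = Suc s mod (4 * m)"
    using m4 by (auto simp: i_def s_def t_def prev_less mod_Suc_eq)
  have XYZ: "xv i + yv (prev i) + (yv i + 3 * int m) = 0"
    by (simp add: xv_def zv_def)
  have Z: "9 * int m + 1 \<le> yv i + 3 * int m \<or> yv i + 3 * int m \<le> - (2 * int m) - 1"
    using yv_cases[OF i(1)] by linarith
  have uv: "1 \<le> u j \<and> u j \<le> 4 * int m" "1 \<le> v j \<and> v j \<le> 4 * int m" for j
    using U_bounds st by (simp_all add: u_def v_def)
  have D: "\<bar>D\<bar> \<le> 4" "even D"
    using zig_step(1)[OF st(1,3)] by (simp_all add: D_def)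
  \<comment> \<open>These values occur only at \<open>i = 1\<close> and \<open>i = 3\<close>. Then
    \<open>c\<close> is odd and \<open>t = i\<close> lies on the rising part of
    \<open>zig\<close>.\<close>
  have D0: "0 \<le> D" if "xv i = 1 \<or> xv i = 3"
  proof -
    have "i = 1 \<or> i = 3"
      using that i m_ge by (auto simp: xv_eq split: if_splits)
    then have "odd i"
      by auto
    then have "odd c"
      by (auto simp: i_def even_mod_4m split: if_splits)
    then have "t = i"
      by (simp add: t_def i_def)
    then have "t \<noteq> 0" "t < 2 * m"
      using \<open>i = 1 \<or> i = 3\<close> m_ge by auto
    then show ?thesis
      using zig_step(2)[OF st(1,3)] by (simp add: D_def)
  qed
  have dif: "sg j * (2 * (u j - v j)) = (E (Suc j) - E j) * D" if "j < 2 * p" for j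
    unfolding u_def v_def D_def by (rule U_diff[OF that])
  note prems = XYZ xv_cases[OF i(1)] yv_cases[OF i(2)] Z D D0 uv dif
  have sL: "sum_list L = 0"
    unfolding L_def by (rule sum_cyc_list[OF prems])
  have simpL: "simple_modulo modulus L"
    unfolding L_def modulus_def by (rule simple_cyc_list[OF prems])
  have "List.map_filter (\<lambda>q. arr ((c + 4 * m - q) mod (4 * m)) c) [0..<4 * m] =
      List.map_filter (\<lambda>q. cell q ((c + 4 * m - q) mod (4 * m)) c) [0..<4 * m]"
    unfolding List.map_filter_def using arr_col[OF c] by (auto intro!: map_cong filter_cong)
  also have "\<dots> = L"
  proof -
    have "[pv j True c, pv j False c] = pair u v j" for j
      by (simp add: pv_def pair_def u_def v_def s_def t_def)
    moreover have "idx ((c + 4 * m - (2 * m - 2)) mod (4 * m)) = i"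
    proof -
      have "c + 4 * m - (2 * m - 2) = c + 2 * m + 2"
        using m_ge by simp
      moreover have "(c + 2 * m + 2 + 2 * m) mod (4 * m) = (c + 2) mod (4 * m)"
        using mod_add_self2[of "c + 2" "4 * m"] by (simp add: algebra_simps)
      ultimately show ?thesis
        by (simp add: idx_mod i_def)
    qed
    moreover have "idx ((c + 4 * m - (4 * m - 1)) mod (4 * m)) = prev i"
    proof -
      have "c + 4 * m - (4 * m - 1) = c + 1"
        using m_ge by simp
      moreover have "i = Suc (if even c then c + 1 + 2 * m else c + 1) mod (4 * m)"
        by (simp add: i_def)
      ultimately show ?thesis
        unfolding idx_mod by (simp only: prev_Suc_mod) simp
    qed
    moreover have "zv (idx ((c + 4 * m - (4 * m - 3)) mod (4 * m))) = yv i + 3 * int m"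
    proof -
      have "c + 4 * m - (4 * m - 3) = c + 3"
        using m_ge by simp
      moreover have "idx ((c + 3) mod (4 * m)) = Suc (if even c then c + 2 * m + 2 else c + 2) mod (4 * m)"
        unfolding idx_mod by (simp add: numeral_3_eq_3)
      ultimately show ?thesis
        by (simp only: zv_def prev_Suc_mod i_def)
    qed
    ultimately show ?thesis
      unfolding map_filter_cell L_def cyc_list_def by simp
  qed
  finally have L: "List.map_filter (\<lambda>q. arr ((c + 4 * m - q) mod (4 * m)) c) [0..<4 * m] = L" .
  note col_entries_cyclic[where A = arr and n = "4 * m" and c = c, OF L sL]
  then show "sum_list (col_entries (4 * m) arr c) = 0"
      "length (col_entries (4 * m) arr c) = 4 * p + 3"
      "simple_modulo modulus (col_entries (4 * m) arr c)"
    using sL simpL length_cyc_list unfolding L_def by (metis sum_mset_sum_list, metis size_mset, blast)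
qed

section \<open>Every absolute value up to \<open>nk\<close> occurs\<close>

text \<open>The values of \<open>x\<close> cover \<open>1..2m\<close> and \<open>3m+1..5m\<close>,
  those of \<open>y\<close> cover \<open>5m+1..8m\<close> and \<open>11m+1..12m\<close>, and those
  of \<open>z\<close> cover \<open>2m+1..3m\<close> and \<open>8m+1..11m\<close>.\<close>

lemma small_cover:
  assumes "1 \<le> v" "v \<le> 12 * int m"
  shows "\<exists>i<4 * m. \<bar>xv i\<bar> = v \<or> \<bar>yv i\<bar> = v \<or> \<bar>zv i\<bar> = v"
proof -
  have y: "\<exists>i<4 * m. \<bar>yv i\<bar> = v" if "\<bar>yv i\<bar> = v" "i < 4 * m" for i
    using that by blast
  have z: "\<exists>i<4 * m. \<bar>zv i\<bar> = v" if "\<bar>yv i + 3 * int m\<bar> = v" "i < 4 * m" for i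
    using that prev_Suc_mod[of i] m_ge by (intro exI[of _ "Suc i mod (4 * m)"]) (simp add: zv_def)
  consider "v < 2 * int m" | "v = 2 * int m" | "2 * int m + 1 \<le> v" "v \<le> 3 * int m" | "3 * int m + 1 \<le> v" "v \<le> 5 * int m"
    | "5 * int m + 1 \<le> v" "v \<le> 6 * int m" | "6 * int m + 1 \<le> v" "v \<le> 8 * int m" | "8 * int m + 1 \<le> v" "v \<le> 9 * int m"
    | "9 * int m + 1 \<le> v" "v \<le> 11 * int m" | "11 * int m + 1 \<le> v"
    by linarith
  then show ?thesis
  proof cases
    case 1
    then show ?thesis
      using assms by (intro exI[of _ "nat v"]) (auto simp: xv_eq)
  next
    case 2
    then show ?thesis
      using m_ge by (intro exI[of _ 0]) (auto simp: xv_eq)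
  next
    case 3
    then have "\<bar>yv (2 * nat (v - int m - 1)) + 3 * int m\<bar> = v"
      by (simp add: yv_def)
    then show ?thesis
      using 3 z[of "2 * nat (v - int m - 1)"] by fastforce
  next
    case 4
    then show ?thesis
      using m_ge by (intro exI[of _ "nat (7 * int m - v)"]) (auto simp: xv_eq)
  next
    case 5
    then have "\<bar>yv (2 * nat (v - 4 * int m - 1))\<bar> = v"
      by (simp add: yv_def)
    then show ?thesis
      using 5 y[of "2 * nat (v - 4 * int m - 1)"] by fastforce
  next
    case 6
    then have "\<bar>yv (2 * nat (8 * int m - v) + 1)\<bar> = v"
      using m_ge by (simp add: yv_def)
    then show ?thesis
      using 6 y[of "2 * nat (8 * int m - v) + 1"] by fastforce
  next
    case 7
    then have "\<bar>yv (2 * nat (v - 8 * int m - 1)) + 3 * int m\<bar> = v"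
      by (simp add: yv_def)
    then show ?thesis
      using 7 z[of "2 * nat (v - 8 * int m - 1)"] by fastforce
  next
    case 8
    then have "\<bar>yv (2 * nat (11 * int m - v) + 1) + 3 * int m\<bar> = v"
      using m_ge by (simp add: yv_def)
    then show ?thesis
      using 8 z[of "2 * nat (11 * int m - v) + 1"] by fastforce
  next
    case 9
    then have "\<bar>yv (2 * nat (v - 11 * int m - 1))\<bar> = v"
      using assms by (simp add: yv_def)
    then show ?thesis
      using 9 assms y[of "2 * nat (v - 11 * int m - 1)"] by fastforce
  qed
qed

text \<open>Division by \<open>8m\<close> finds the block \<open>B\<close> of \<open>v\<close>, and
  the parity of the position decides between its two halves. Blocks \<open>2..p\<close> belong to
  pair \<open>p - B\<close>, later ones to pair \<open>B - 1\<close>, and blocks 0 and 1 are split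
  between the pairs \<open>p - 1\<close> and \<open>2p - 1\<close>.\<close>

lemma large_cover:
  assumes "12 * int m < v" "v \<le> 4 * int m * (4 * int p + 3)"
  shows "\<exists>j<2 * p. \<exists>w. 1 \<le> w \<and> w \<le> 4 * int m \<and> (v = al j + 2 * w \<or> v = be j + 2 * w)"
proof -
  define x where "x = v - 12 * int m - 1"
  define B r where "B = x div (8 * int m)" and "r = x mod (8 * int m)"
  define w where "w = r div 2 + 1"
  have m8: "0 < 8 * int m"
    using m_ge by simp
  have x: "0 \<le> x" "x < (2 * int p) * (8 * int m)"
    using assms by (simp_all add: x_def algebra_simps)
  have r: "0 \<le> r" "r < 8 * int m"
    unfolding r_def using m8 by simp_all
  have "B * (8 * int m) < 2 * int p * (8 * int m)"
    using x(2) r(1) div_mult_mod_eq[of x "8 * int m"] unfolding B_def r_def by linarith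
  then have B: "0 \<le> B" "B < 2 * int p"
    using x(1) m8 by (simp_all only: B_def pos_imp_zdiv_nonneg_iff mult_less_cancel_right_pos)
  have w: "1 \<le> w" "w \<le> 4 * int m"
    unfolding w_def using r by linarith+
  have "x = 8 * (int m * B) + r"
    using div_mult_mod_eq[of x "8 * int m"] by (simp add: B_def r_def algebra_simps)
  moreover have "r = 2 * w - 2 \<or> r = 2 * w - 1"
    unfolding w_def by presburger
  ultimately have v: "v = 12 * int m + 8 * (int m * B) - 1 + 2 * w \<or> v = 12 * int m + 8 * (int m * B) + 2 * w"
    unfolding x_def by linarith
  \<comment> \<open>Writing \<open>p - 1\<close> as \<open>l\<close> avoids truncated subtraction in
    the two exceptional pairs.\<close>
  obtain l where l: "p = Suc l"
    using p_pos gr0_implies_Suc by blast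
  have l_eq: "al l = 20 * int m - 1" "be l = 12 * int m - 1" "al (2 * l + 1) = 20 * int m"
      "be (2 * l + 1) = 12 * int m" and l_less: "l < 2 * p" "2 * l + 1 < 2 * p"
    unfolding al_def be_def by (simp_all add: l)
  consider "B = 0" | "B = 1" | "2 \<le> B" "B \<le> p" | "int p + 1 \<le> B"
    using B by linarith
  then have "\<exists>j k. j < 2 * p \<and> k < 2 * p \<and>
      (12 * int m + 8 * (int m * B) - 1 = al j \<or> 12 * int m + 8 * (int m * B) - 1 = be j) \<and>
      (12 * int m + 8 * (int m * B) = al k \<or> 12 * int m + 8 * (int m * B) = be k)"
  proof cases
    case 1
    show ?thesis
      by (rule exI[of _ l], rule exI[of _ "2 * l + 1"]) (simp only: l_eq l_less 1, simp)
  next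
    case 2
    show ?thesis
      by (rule exI[of _ l], rule exI[of _ "2 * l + 1"]) (simp only: l_eq l_less 2, simp)
  next
    case 3
    then show ?thesis
      using p_pos by (intro exI[of _ "p - nat B"]) (auto simp: al_def be_def of_nat_diff)
  next
    case 4
    then show ?thesis
      using p_pos B by (intro exI[of _ "nat B - 1"]) (auto simp: al_def be_def of_nat_diff)
  qed
  with v w show ?thesis
    by metis
qed

lemma arr_entry:
  assumes "r < 4 * m" "q < 4 * m" "cell q r ((q + r) mod (4 * m)) = Some y" "\<bar>y\<bar> = v"
  shows "\<exists>i<4 * m. \<exists>j<4 * m. arr i j = Some v \<or> arr i j = Some (- v)"
proof -
  have "(q + r) mod (4 * m) < 4 * m"
    using assms by simp
  moreover have "y = v \<or> y = - v"
    using assms(4) by linarith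
  ultimately show ?thesis
    using assms arr_row[OF assms(1,2)] by metis
qed

lemma off_less: "j < 2 * p \<Longrightarrow> Suc (off j) < 4 * m"
  using m_ge by (auto simp: off_def)

lemma cell_off:
  assumes "j < 2 * p"
  shows "cell (off j) r c = Some (pv j True c)" "cell (Suc (off j)) r c = Some (pv j False c)"
proof -
  have "cell (off j) r c = Some (pv j True c) \<and> cell (Suc (off j)) r c = Some (pv j False c)"
  proof (cases "j < p")
    case True
    then show ?thesis
      by (simp add: cell_def off_def)
  next
    case False
    define k i where "k = 2 * m - 1" and "i = j - p"
    have ji: "j = p + i" "i < p"
      using False assms by (simp_all add: i_def)
    have "\<not> k + a < 2 * p" "k + a \<noteq> 2 * m - 2" "\<not> Suc (k + a) < 2 * p" "Suc (k + a) \<noteq> 2 * m - 2" for a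
      using m_ge by (simp_all add: k_def)
    moreover have "off j = k + 2 * i"
      using ji by (simp add: off_def k_def)
    moreover have "Suc (k + 2 * i) - k = Suc (2 * i)"
      by simp
    ultimately show ?thesis
      using ji by (simp add: cell_def del: One_nat_def flip: k_def)
  qed
  then show "cell (off j) r c = Some (pv j True c)" "cell (Suc (off j)) r c = Some (pv j False c)"
    by simp_all
qed

lemma arr_cover:
  assumes "1 \<le> v" "v \<le> 4 * int m * (4 * int p + 3)"
  shows "\<exists>i<4 * m. \<exists>j<4 * m. arr i j = Some v \<or> arr i j = Some (- v)"
proof (cases "v \<le> 12 * int m")
  case True
  then obtain i where i: "i < 4 * m" "\<bar>xv i\<bar> = v \<or> \<bar>yv i\<bar> = v \<or> \<bar>zv i\<bar> = v"
    using small_cover[OF assms(1)] by blast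
  have q: "2 * m - 2 < 4 * m" "4 * m - 3 < 4 * m" "4 * m - 1 < 4 * m"
    using m_ge by linarith+
  show ?thesis
    using i(2) arr_entry[OF idx_less q(1) cell_simps(1), of i v] arr_entry[OF idx_less q(2) cell_simps(2), of i v]
      arr_entry[OF idx_less q(3) cell_simps(4), of i v]
    unfolding idx_idx[OF i(1)] by blast
next
  case False
  then obtain j w where j: "j < 2 * p" and w: "1 \<le> w" "w \<le> 4 * int m"
    and v: "v = al j + 2 * w \<or> v = be j + 2 * w"
    using large_cover[of v] assms by auto
  obtain t where t: "t < 4 * m" "U j t = w"
    using U_surj[OF w] by blast
  have entry: "\<bar>pv j left c\<bar> = v" if "v = (if left then al j else be j) + 2 * w"
    "(c + (if left then 2 else 1)) mod (4 * m) = t" for left c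
  proof -
    have "sg j = 1 \<or> sg j = - 1"
      by (simp add: sg_def)
    then show ?thesis
      using that t assms(1) by (auto simp: pv_def split: if_splits)
  qed
  \<comment> \<open>This is the row in which diagonal \<open>q\<close> meets the column where
    \<open>U\<close> has argument \<open>t\<close>. Adding \<open>8m\<close> rather than
    \<open>4m\<close> keeps the natural subtraction exact, as \<open>q + a\<close> may exceed
    \<open>4m\<close>.\<close>
  have shift: "((q + (t + 8 * m - q - a) mod (4 * m)) mod (4 * m) + a) mod (4 * m) = t"
    if "q < 4 * m" "a < 4 * m" for q a
  proof -
    have "((q + (t + 8 * m - q - a) mod (4 * m)) mod (4 * m) + a) mod (4 * m) =
        (q + (t + 8 * m - q - a) + a) mod (4 * m)"
      by (simp add: mod_simps)
    also have "q + (t + 8 * m - q - a) + a = t + 2 * (4 * m)"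
      using that by simp
    also have "(t + 2 * (4 * m)) mod (4 * m) = t"
      using t(1) by (simp only: mod_mult_self1 mod_less)
    finally show ?thesis .
  qed
  have less: "(t + 8 * m - q - a) mod (4 * m) < 4 * m" for q a
    using m_ge by simp
  from v show ?thesis
  proof
    assume "v = al j + 2 * w"
    moreover have "off j < 4 * m" "2 < 4 * m"
      using off_less[OF j] m_ge by simp_all
    ultimately show ?thesis
      using entry[of True] shift[of "off j" 2]
      by (intro arr_entry[OF less[of "off j" 2] _ cell_off(1)[OF j]]) simp_all
  next
    assume "v = be j + 2 * w"
    moreover have "Suc (off j) < 4 * m" "1 < 4 * m"
      using off_less[OF j] m_ge by simp_all
    ultimately show ?thesis
      using entry[of False] shift[of "Suc (off j)" 1]
      by (intro arr_entry[OF less[of "Suc (off j)" 1] _ cell_off(2)[OF j]]) simp_all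
  qed
qed

lemma heffter_array_arr: "heffter_array (4 * m) (4 * p + 3) arr"
  unfolding heffter_array_def card_row_col_entries
  using row_cyclic(1,2) col_cyclic(1,2) arr_cover by (auto simp: algebra_simps)

lemma globally_simple_arr: "globally_simple (4 * m) (4 * p + 3) arr"
proof -
  have "int (2 * (4 * m) * (4 * p + 3) + 1) = modulus"
    by (simp add: modulus_def algebra_simps)
  then show ?thesis
    unfolding globally_simple_def using row_cyclic(3) col_cyclic(3) by simp
qed

end

theorem theorem1p7:
  shows "\<exists>(c::real) (n0::nat). c > 0 \<and>
           (\<forall>(n::nat) (p::nat).
              n > 0 \<longrightarrow> [n = 0] (mod 4) \<longrightarrow> p > 0 \<longrightarrow> n \<ge> n0 \<longrightarrow>
              real n - 4 * real p \<ge> c * (ln (real n))\<^sup>2 \<longrightarrow>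
              (\<exists>A. heffter_array n (4 * p + 3) A \<and> globally_simple n (4 * p + 3) A))"
proof (rule exI[of _ 12], rule exI[of _ 3], intro conjI allI impI)
  fix n p :: nat
  assume "0 < n" and *: "[n = 0] (mod 4)" "0 < p" "3 \<le> n" "12 * (ln (real n))\<^sup>2 \<le> real n - 4 * real p"
  \<comment> \<open>From \<open>n \<ge> 3 > e\<close> the logarithm is at least 1, so the constant
    12 yields \<open>n - 4p \<ge> 12\<close>, which is \<open>p + 3 \<le> m\<close>.\<close>
  have "exp 1 \<le> real n"
    using exp_le \<open>3 \<le> n\<close> by linarith
  then have "1 \<le> ln (real n)"
    using \<open>3 \<le> n\<close> by (simp add: ln_ge_iff)
  then have "1 \<le> (ln (real n))\<^sup>2"
    by simp
  then have "4 * p + 12 \<le> n"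
    using *(4) by linarith
  moreover obtain m where m: "n = 4 * m"
    using *(1) by (auto simp: cong_def elim: dvdE)
  ultimately interpret heffter_params m p
    using *(2) by unfold_locales auto
  show "\<exists>A. heffter_array n (4 * p + 3) A \<and> globally_simple n (4 * p + 3) A"
    using heffter_array_arr globally_simple_arr unfolding m by blast
qed simp

end
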